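(* Let $k$ be an algebraically closed field of characteristic $p>0$, and let $V\subset \mathbb{A}^n_k$, $W\subset \mathbb{A}^m_k$ and $U\subset \mathbb{A}^\ell_k$ be algebraic sets (defined by polynomials with degrees in $\mathbb{Z}[1/p]_{\ge 0}$). 1. A polynomial map $\phi: V \to W$ induces a $k$-algebra homomorphism $\phi^* : k[W]_{\mathbb{Z}[1/p]} \to k[V]_{\mathbb{Z}[1/p]}$, defined by composition of functions; that is, if $g \in k[W]_{\mathbb{Z}[1/p]}$ is a polynomial function then so is $\phi^*(g) = g \circ \phi$. 2. If $\phi:V\to W$ and $\varphi:W\to U$ are polynomial maps, then $(\varphi\circ\phi)^*=\phi^*\circ\varphi^*$. 3. If $\Phi:k[W]_{\mathbb{Z}[1/p]}\to k[V]_{\mathbb{Z}[1/p]}$ is a $k$-algebra homomorphism, then it is of the form $\Phi=\phi^*$, where $\phi:V\to W$ is a unique polynomial map.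
   Context: Let $k$ be an algebraically closed field of characteristic $p>0$. Define $k[X_1,\ldots,X_n]_{\mathbb{Z}[1/p]}=\bigcup_{i\ge 0} k[X_1,X_1^{1/p},\ldots,X_1^{1/p^i},\ldots,X_n,X_n^{1/p},\ldots,X_n^{1/p^i}]$, where the $X_j^{1/p^i}$ are formally adjoined compatible roots of $X_j$; its elements are finite $k$-linear combinations of monomials $X_1^{r_1}\cdots X_n^{r_n}$ with $r_j\in\mathbb{Z}[1/p]_{\ge 0}$. Such an element is evaluated at a point $x\in\mathbb{A}^n_k=k^n$ using the unique $p^i$-th roots $x_j^{1/p^i}\in k$. An algebraic set $V\subset\mathbb{A}^n_k$ is the set of common zeros in $k^n$ of some subset of $k[X_1,\ldots,X_n]_{\mathbb{Z}[1/p]}$. The ideal $I(V)$ is the set of all $f\in k[X_1,\ldots,X_n]_{\mathbb{Z}[1/p]}$ with $f(x)=0$ for all $x\in V$, and $k[V]_{\mathbb{Z}[1/p]}=k[X_1,\ldots,X_n]_{\mathbb{Z}[1/p]}/I(V)$, regarded as the ring of polynomial functions on $V$. For algebraic sets $V\subset\mathbb{A}^n_k$ and $W\subset\mathbb{A}^m_k$, a map $\phi:V\to W$ is a polynomial map if there are $\phi_1,\ldots,\phi_m\in k[X_1,\ldots,X_n]_{\mathbb{Z}[1/p]}$ such that $\phi(x)=(\phi_1(x),\ldots,\phi_m(x))$ for all $x\in V$. (Since $k$ has characteristic $p$, $(a+b)^{1/p}=a^{1/p}+b^{1/p}$, so compositions of polynomial maps are polynomial maps.) *)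

theory Defs
  imports
    "HOL-Library.Poly_Mapping"
    "HOL-Library.FuncSet"
    "HOL-Computational_Algebra.Polynomial"
    "HOL-Computational_Algebra.Primes"
    "HOL-Algebra.QuotRing"
begin

section \<open>Polynomials with exponents in \<open>\<int>[1/p]\<^sub>\<ge>\<^sub>0\<close>\<close>

definition zinvp_nonneg :: "nat \<Rightarrow> rat set" where
  "zinvp_nonneg p = {of_nat a / of_nat (p ^ i) | a i. True}"

text \<open>
  A monomial is the finitely supported family of its exponents; the variables are numbered
  from \<open>0\<close> to \<open>n - 1\<close>. Multiplication in \<open>(nat \<Rightarrow>\<^sub>0 rat) \<Rightarrow>\<^sub>0 'k\<close> is
  convolution, so it adds exponents.
\<close>

type_synonym 'k frac_poly = "(nat \<Rightarrow>\<^sub>0 rat) \<Rightarrow>\<^sub>0 'k"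

definition frac_polys :: "nat \<Rightarrow> ('k :: alg_closed_field) frac_poly set" where
  "frac_polys n = {f. \<forall>\<mu>\<in>Poly_Mapping.keys f.
     Poly_Mapping.keys \<mu> \<subseteq> {..<n} \<and>
     (\<forall>j. Poly_Mapping.lookup \<mu> j \<in> zinvp_nonneg CHAR('k))}"

definition frac_poly_ring :: "nat \<Rightarrow> ('k :: alg_closed_field) frac_poly ring" where
  "frac_poly_ring n =
     \<lparr>carrier = frac_polys n, mult = (*), one = 1, zero = 0, add = (+)\<rparr>"

definition const_poly :: "'k :: alg_closed_field \<Rightarrow> 'k frac_poly" where
  "const_poly c = Poly_Mapping.single 0 c"


section \<open>Evaluation\<close>

definition frob_root :: "nat \<Rightarrow> 'k :: alg_closed_field \<Rightarrow> 'k" where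
  "frob_root i x = (THE z. z ^ (CHAR('k) ^ i) = x)"

text \<open>The power \<open>x\<^sup>r\<close> does not depend on how \<open>r = a / p\<^sup>i\<close> is written; see
  \<open>frac_pow_eq\<close> below.\<close>

definition frac_pow :: "'k :: alg_closed_field \<Rightarrow> rat \<Rightarrow> 'k" where
  "frac_pow x r = (THE y. \<forall>a i. r = of_nat a / of_nat (CHAR('k) ^ i) \<longrightarrow> y = frob_root i x ^ a)"

definition eval_fp :: "('k :: alg_closed_field) frac_poly \<Rightarrow> (nat \<Rightarrow> 'k) \<Rightarrow> 'k" where
  "eval_fp f x = (\<Sum>\<mu>\<in>Poly_Mapping.keys f. Poly_Mapping.lookup f \<mu> *
     (\<Prod>j\<in>Poly_Mapping.keys \<mu>. frac_pow (x j) (Poly_Mapping.lookup \<mu> j)))"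


section \<open>Algebraic sets and their coordinate rings\<close>

text \<open>Points of \<open>k\<^sup>n\<close> are functions on \<open>{..<n}\<close>, extended by \<open>undefined\<close>.\<close>

definition affine_space :: "nat \<Rightarrow> (nat \<Rightarrow> 'k :: alg_closed_field) set" where
  "affine_space n = {..<n} \<rightarrow>\<^sub>E UNIV"

definition algebraic_set :: "nat \<Rightarrow> (nat \<Rightarrow> 'k :: alg_closed_field) set \<Rightarrow> bool" where
  "algebraic_set n V \<longleftrightarrow>
     (\<exists>S \<subseteq> frac_polys n. V = {x \<in> affine_space n. \<forall>f\<in>S. eval_fp f x = 0})"

definition vanishing_ideal ::
    "nat \<Rightarrow> (nat \<Rightarrow> 'k :: alg_closed_field) set \<Rightarrow> 'k frac_poly set" where
  "vanishing_ideal n V = {f \<in> frac_polys n. \<forall>x\<in>V. eval_fp f x = 0}"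

definition coord_ring ::
    "nat \<Rightarrow> (nat \<Rightarrow> 'k :: alg_closed_field) set \<Rightarrow> 'k frac_poly set ring" where
  "coord_ring n V = frac_poly_ring n Quot vanishing_ideal n V"

text \<open>The structure map of the \<open>k\<close>-algebra \<^term>\<open>coord_ring n V\<close>.\<close>

definition coord_const ::
    "nat \<Rightarrow> (nat \<Rightarrow> 'k :: alg_closed_field) set \<Rightarrow> 'k \<Rightarrow> 'k frac_poly set" where
  "coord_const n V c = vanishing_ideal n V +>\<^bsub>frac_poly_ring n\<^esub> const_poly c"

text \<open>The function on \<open>V\<close> given by a residue class: all its members have the same value at
  a point of \<open>V\<close>.\<close>

definition coord_fun ::
    "(nat \<Rightarrow> 'k :: alg_closed_field) set \<Rightarrow> 'k frac_poly set \<Rightarrow> (nat \<Rightarrow> 'k) \<Rightarrow> 'k" where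
  "coord_fun V g = (\<lambda>x\<in>V. the_elem ((\<lambda>f. eval_fp f x) ` g))"

definition k_algebra_homs ::
    "nat \<Rightarrow> (nat \<Rightarrow> 'k :: alg_closed_field) set \<Rightarrow> nat \<Rightarrow> (nat \<Rightarrow> 'k) set \<Rightarrow>
      ('k frac_poly set \<Rightarrow> 'k frac_poly set) set" where
  "k_algebra_homs m W n V =
     {\<Phi> \<in> ring_hom (coord_ring m W) (coord_ring n V).
        \<forall>c. \<Phi> (coord_const m W c) = coord_const n V c}"


section \<open>Polynomial maps\<close>

definition polynomial_maps ::
    "nat \<Rightarrow> (nat \<Rightarrow> 'k :: alg_closed_field) set \<Rightarrow> nat \<Rightarrow> (nat \<Rightarrow> 'k) set \<Rightarrow>
      ((nat \<Rightarrow> 'k) \<Rightarrow> (nat \<Rightarrow> 'k)) set" where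
  "polynomial_maps n V m W =
     {\<phi> \<in> V \<rightarrow>\<^sub>E W. \<exists>P. (\<forall>j<m. P j \<in> frac_polys n) \<and>
        (\<forall>x\<in>V. \<phi> x = (\<lambda>j\<in>{..<m}. eval_fp (P j) x))}"

text \<open>\<open>\<phi>\<^sup>*\<close> sends \<open>g\<close> to the element of the coordinate ring of \<open>V\<close> whose function is
  \<open>g \<circ> \<phi>\<close>.\<close>

definition pullback ::
    "nat \<Rightarrow> (nat \<Rightarrow> 'k :: alg_closed_field) set \<Rightarrow> nat \<Rightarrow> (nat \<Rightarrow> 'k) set \<Rightarrow>
      ((nat \<Rightarrow> 'k) \<Rightarrow> (nat \<Rightarrow> 'k)) \<Rightarrow> 'k frac_poly set \<Rightarrow> 'k frac_poly set" where
  "pullback n V m W \<phi> =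
     (\<lambda>g\<in>carrier (coord_ring m W).
        the_inv_into (carrier (coord_ring n V)) (coord_fun V) (compose V (coord_fun W g) \<phi>))"


section \<open>Well-definedness\<close>

lemma frob_root_ex1:
  fixes x :: "'k :: alg_closed_field"
  assumes "CHAR('k) > 0"
  shows "\<exists>!z. z ^ (CHAR('k) ^ i) = x"
proof -
  let ?q = "CHAR('k) ^ i"
  have pr: "prime CHAR('k)"
    using assms by (rule prime_CHAR_semidom)
  have "?q > 0" using assms by simp
  then obtain z where z: "z ^ ?q = x"
    using nth_root_exists[of ?q x] by blast
  moreover have "y = z" if "y ^ ?q = x" for y
  proof -
    have "(y - z + z) ^ ?q = (y - z) ^ ?q + z ^ ?q"
      using pr by (intro freshmans_dream') auto
    then have "(y - z) ^ ?q = 0" using that z by simp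
    then show ?thesis by simp
  qed
  ultimately show ?thesis by blast
qed

lemma frob_root_power:
  fixes x :: "'k :: alg_closed_field"
  assumes "CHAR('k) > 0"
  shows "frob_root i x ^ (CHAR('k) ^ i) = x"
  unfolding frob_root_def by (rule theI'[OF frob_root_ex1[OF assms]])

lemma frac_pow_eq:
  fixes x :: "'k :: alg_closed_field"
  assumes "CHAR('k) > 0"
  shows "frac_pow x (of_nat a / of_nat (CHAR('k) ^ i)) = frob_root i x ^ a"
proof -
  let ?p = "CHAR('k)"
  have "frob_root i x ^ a = frob_root j x ^ b"
    if "(of_nat a / of_nat (?p ^ i) :: rat) = of_nat b / of_nat (?p ^ j)" for b j
  proof -
    have "(of_nat (?p ^ i) :: rat) \<noteq> 0" "(of_nat (?p ^ j) :: rat) \<noteq> 0"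
      using assms by auto
    then have "(of_nat (a * ?p ^ j) :: rat) = of_nat (b * ?p ^ i)"
      unfolding of_nat_mult using that frac_eq_eq by blast
    then have ab: "a * ?p ^ j = b * ?p ^ i" by (simp only: of_nat_eq_iff)
    have "(frob_root i x ^ a) ^ (?p ^ (i + j)) = (frob_root i x ^ (?p ^ i)) ^ (a * ?p ^ j)"
      by (simp only: power_mult [symmetric] power_add ac_simps)
    also have "\<dots> = (frob_root j x ^ (?p ^ j)) ^ (b * ?p ^ i)"
      by (simp only: frob_root_power[OF assms] ab)
    also have "\<dots> = (frob_root j x ^ b) ^ (?p ^ (i + j))"
      by (simp only: power_mult [symmetric] power_add ac_simps)
    finally show ?thesis using frob_root_ex1[OF assms] by metis
  qed
  then show ?thesis unfolding frac_pow_def by (intro the_equality) blast+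
qed

end

(*
  Evaluation identifies k[V] with a ring of k-valued functions on V. In characteristic p the
  p^i-th root is additive and multiplicative, so polynomial functions are closed under it; hence
  fractional powers, and with them compositions, of polynomial functions are polynomial functions.

  Conversely, a k-algebra homomorphism Phi : k[W] -> k[V] followed by evaluation at x in V is a
  homomorphism theta into k. Since p^i-th roots in k are unique, theta commutes with fractional
  powers of the variables, so theta is evaluation at the point (theta X_0, ..., theta X_{m-1}).
  This point lies on W because theta kills I(W), and it is the value at x of the only map that
  can induce Phi.
*)

theory Submission
  imports Defs
begin

subsection \<open>Fractional powers\<close>

lemma zinvp_nonneg_0 [simp]: "0 \<in> zinvp_nonneg p"
  unfolding zinvp_nonneg_def by (auto intro!: exI[of _ 0])

lemma zinvp_nonneg_1 [simp]: "1 \<in> zinvp_nonneg p"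
  unfolding zinvp_nonneg_def by (auto intro!: exI[of _ 1] exI[of _ 0])

lemma zinvp_nonneg_add:
  assumes "p > 0" "r \<in> zinvp_nonneg p" "s \<in> zinvp_nonneg p"
  shows "r + s \<in> zinvp_nonneg p"
proof -
  obtain a i b j where rs: "r = of_nat a / of_nat (p ^ i)" "s = of_nat b / of_nat (p ^ j)"
    using assms(2,3) unfolding zinvp_nonneg_def by blast
  have "r + s = of_nat (a * p ^ j + b * p ^ i) / of_nat (p ^ (i + j))"
    using assms(1) unfolding rs by (simp add: field_simps power_add)
  then show ?thesis unfolding zinvp_nonneg_def by blast
qed

lemma zinvp_nonneg_divide:
  assumes "r \<in> zinvp_nonneg p"
  shows "r / of_nat (p ^ i) \<in> zinvp_nonneg p"
proof -
  obtain a j where r: "r = of_nat a / of_nat (p ^ j)"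
    using assms unfolding zinvp_nonneg_def by blast
  have "r / of_nat (p ^ i) = of_nat a / of_nat (p ^ (j + i))"
    unfolding r by (simp add: power_add)
  then show ?thesis unfolding zinvp_nonneg_def by blast
qed

context
  assumes char_pos: "CHAR('k :: alg_closed_field) > 0"
begin

text \<open>Since \<open>p^i\<close>-th roots in k exist and are unique, a value of
  \<open>frob_root\<close> can be verified after raising to the power \<open>CHAR('k) ^ i\<close>.
  The rules for 0, 1, products and sums below rest on this.\<close>

lemma frob_root_eqI:
  fixes x z :: 'k
  shows "z ^ (CHAR('k) ^ i) = x \<Longrightarrow> frob_root i x = z"
  using frob_root_ex1[OF char_pos, of i x] frob_root_power[OF char_pos, of i x] by blast

lemma frob_root_0: "frob_root i (0 :: 'k) = 0"
  using char_pos by (intro frob_root_eqI) simp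

lemma frob_root_1: "frob_root i (1 :: 'k) = 1"
  by (intro frob_root_eqI) simp

lemma frob_root_mult: "frob_root i (x * y :: 'k) = frob_root i x * frob_root i y"
  by (intro frob_root_eqI) (simp add: power_mult_distrib frob_root_power[OF char_pos])

text \<open>The Frobenius map is additive in characteristic p, so its inverse is additive too. This
  is what lets roots pass through polynomial expressions.\<close>

lemma frob_root_add: "frob_root i (x + y :: 'k) = frob_root i x + frob_root i y"
proof (rule frob_root_eqI)
  have "prime CHAR('k)" using char_pos by (rule prime_CHAR_semidom)
  then show "(frob_root i x + frob_root i y) ^ (CHAR('k) ^ i) = x + y"
    by (simp add: freshmans_dream' frob_root_power[OF char_pos])
qed

lemma frob_root_sum: "frob_root i (sum f A :: 'k) = (\<Sum>a\<in>A. frob_root i (f a))"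
  by (induction A rule: infinite_finite_induct) (simp_all add: frob_root_0 frob_root_add)

lemma frob_root_prod: "frob_root i (prod f A :: 'k) = (\<Prod>a\<in>A. frob_root i (f a))"
  by (induction A rule: infinite_finite_induct) (simp_all add: frob_root_1 frob_root_mult)

text \<open>Pins down a fractional power by an equation without roots: a candidate only needs the
  right \<open>p^i\<close>-th power. It holds because the powers a and \<open>p^i\<close> commute
  and \<open>p^i\<close>-th roots are unique.\<close>

lemma frac_pow_eqI:
  fixes x y :: 'k
  assumes "y ^ (CHAR('k) ^ i) = x ^ a"
  shows "frac_pow x (of_nat a / of_nat (CHAR('k) ^ i)) = y"
proof -
  have "(frob_root i x ^ a) ^ (CHAR('k) ^ i) = (frob_root i x ^ (CHAR('k) ^ i)) ^ a"
    by (simp only: power_mult [symmetric] mult.commute)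
  also have "\<dots> = y ^ (CHAR('k) ^ i)" using assms frob_root_power[OF char_pos, of i x] by simp
  finally have "frob_root i x ^ a = y"
    using frob_root_ex1[OF char_pos, of i "y ^ (CHAR('k) ^ i)"] by blast
  then show ?thesis by (simp only: frac_pow_eq[OF char_pos])
qed

text \<open>The base \<open>x = 0\<close> is covered because \<open>0 ^ 0 = 1\<close>. Hence a
  variable missing from a monomial contributes the factor 1.\<close>

lemma frac_pow_0 [simp]: "frac_pow (x :: 'k) 0 = 1"
  using frac_pow_eqI[of 1 0 x 0] by simp

lemma frac_pow_1 [simp]: "frac_pow (x :: 'k) 1 = x"
  using frac_pow_eqI[of x 0 x 1] by simp

lemma frac_pow_power:
  "frac_pow (x :: 'k) (of_nat a / of_nat (CHAR('k) ^ i)) ^ (CHAR('k) ^ i) = x ^ a"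
proof -
  have "(frob_root i x ^ a) ^ (CHAR('k) ^ i) = (frob_root i x ^ (CHAR('k) ^ i)) ^ a"
    by (simp only: power_mult [symmetric] mult.commute)
  then show ?thesis by (simp only: frac_pow_eq[OF char_pos] frob_root_power[OF char_pos])
qed

text \<open>Both sides have the same power with exponent \<open>p^(i+j)\<close>, the product of the
  two denominators, and roots are unique. The hypotheses matter: for other exponents the description
  defining \<open>frac_pow\<close> does not single out a value.\<close>

lemma frac_pow_add:
  fixes x :: 'k
  assumes "r \<in> zinvp_nonneg CHAR('k)" "s \<in> zinvp_nonneg CHAR('k)"
  shows "frac_pow x (r + s) = frac_pow x r * frac_pow x s"
proof -
  let ?p = "CHAR('k)"
  obtain a i b j where rs: "r = of_nat a / of_nat (?p ^ i)" "s = of_nat b / of_nat (?p ^ j)"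
    using assms unfolding zinvp_nonneg_def by blast
  have eq: "r + s = of_nat (a * ?p ^ j + b * ?p ^ i) / of_nat (?p ^ (i + j))"
    using char_pos unfolding rs by (simp add: field_simps power_add)
  have "(frac_pow x r * frac_pow x s) ^ (?p ^ (i + j)) =
      (frac_pow x r ^ (?p ^ i)) ^ (?p ^ j) * (frac_pow x s ^ (?p ^ j)) ^ (?p ^ i)"
    by (simp only: power_mult_distrib power_mult [symmetric] power_add ac_simps)
  also have "\<dots> = x ^ (a * ?p ^ j + b * ?p ^ i)"
    unfolding rs frac_pow_power by (simp only: power_add power_mult)
  finally show ?thesis unfolding eq by (rule frac_pow_eqI)
qed

text \<open>Exponents in Z[1/p] can be divided by p, so a root of a fractional power is again a
  fractional power. Both sides have \<open>x ^ a\<close> as their \<open>p^(i+j)\<close>-th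
  power.\<close>

lemma frob_root_frac_pow:
  fixes x :: 'k
  assumes "r \<in> zinvp_nonneg CHAR('k)"
  shows "frob_root i (frac_pow x r) = frac_pow x (r / of_nat (CHAR('k) ^ i))"
proof -
  let ?p = "CHAR('k)"
  obtain a j where r: "r = of_nat a / of_nat (?p ^ j)"
    using assms unfolding zinvp_nonneg_def by blast
  have eq: "r / of_nat (?p ^ i) = of_nat a / of_nat (?p ^ (i + j))"
    unfolding r by (simp add: power_add)
  have "frob_root i (frac_pow x r) ^ (?p ^ (i + j)) =
      (frob_root i (frac_pow x r) ^ (?p ^ i)) ^ (?p ^ j)"
    by (simp only: power_mult [symmetric] power_add)
  also have "\<dots> = x ^ a" by (simp only: frob_root_power[OF char_pos] r frac_pow_power)
  finally show ?thesis unfolding eq by (rule frac_pow_eqI[symmetric])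
qed

end


subsection \<open>The ring of polynomials and evaluation\<close>

text \<open>The inner product of \<open>eval_fp\<close>, split off so that the addition of exponents
  can be treated apart from the coefficients.\<close>

definition eval_monom :: "(nat \<Rightarrow>\<^sub>0 rat) \<Rightarrow> (nat \<Rightarrow> 'k :: alg_closed_field) \<Rightarrow> 'k" where
  "eval_monom \<mu> x = (\<Prod>j\<in>Poly_Mapping.keys \<mu>. frac_pow (x j) (Poly_Mapping.lookup \<mu> j))"

text \<open>Monomials outside the support have coefficient 0. This allows several polynomials to be
  evaluated over one common index set.\<close>

lemma eval_fp_superset:
  assumes "finite A" "Poly_Mapping.keys f \<subseteq> A"
  shows "eval_fp f x = (\<Sum>\<mu>\<in>A. Poly_Mapping.lookup f \<mu> * eval_monom \<mu> x)"
  unfolding eval_fp_def eval_monom_def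
  by (rule sum.mono_neutral_left) (use assms in \<open>auto simp: in_keys_iff\<close>)

lemma eval_fp_add: "eval_fp (f + g) x = eval_fp f x + eval_fp g x"
proof -
  let ?A = "Poly_Mapping.keys f \<union> Poly_Mapping.keys g"
  have "eval_fp (f + g) x = (\<Sum>\<mu>\<in>?A. Poly_Mapping.lookup (f + g) \<mu> * eval_monom \<mu> x)"
    using keys_add[of f g] by (intro eval_fp_superset) auto
  also have "\<dots> = (\<Sum>\<mu>\<in>?A. Poly_Mapping.lookup f \<mu> * eval_monom \<mu> x) +
      (\<Sum>\<mu>\<in>?A. Poly_Mapping.lookup g \<mu> * eval_monom \<mu> x)"
    by (simp add: lookup_add distrib_right sum.distrib)
  also have "\<dots> = eval_fp f x + eval_fp g x"
    by (simp add: eval_fp_superset[of ?A])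
  finally show ?thesis .
qed

lemma eval_fp_0 [simp]: "eval_fp 0 x = 0"
  by (simp add: eval_fp_def)

lemma eval_fp_uminus: "eval_fp (- f) x = - eval_fp f x"
  using eval_fp_add[of "- f" f x] by (simp add: eq_neg_iff_add_eq_0)

lemma eval_fp_diff: "eval_fp (f - g) x = eval_fp f x - eval_fp g x"
  using eval_fp_add[of "f - g" g x] by simp

lemma eval_fp_sum: "eval_fp (sum f A) x = (\<Sum>a\<in>A. eval_fp (f a) x)"
  by (induction A rule: infinite_finite_induct) (simp_all add: eval_fp_add)

lemma eval_fp_single: "eval_fp (Poly_Mapping.single \<mu> c) x = c * eval_monom \<mu> x"
  \<comment> \<open>For \<open>c = 0\<close> the polynomial is zero and has no keys, so the sum is
    empty instead of having one term.\<close>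
  by (cases "c = 0") (simp_all add: eval_fp_def eval_monom_def)

lemma eval_fp_const [simp]: "eval_fp (const_poly c) x = c"
  by (simp add: const_poly_def eval_fp_single eval_monom_def)

lemma eval_fp_1 [simp]: "eval_fp 1 x = 1"
  using eval_fp_single[of 0 1 x] by (simp add: eval_monom_def)

section \<open>Decomposition into monomials and powers of single variables\<close>

text \<open>Used at two levels: for a polynomial as the sum of its terms, and for an exponent family
  as the sum of its one-variable parts.\<close>

lemma poly_mapping_eq_sum_single:
  fixes f :: "'a \<Rightarrow>\<^sub>0 'b :: comm_monoid_add"
  shows "f = (\<Sum>\<mu>\<in>Poly_Mapping.keys f. Poly_Mapping.single \<mu> (Poly_Mapping.lookup f \<mu>))"
  by (rule poly_mapping_eqI)
    (auto simp: lookup_sum lookup_single when_def sum.delta' in_keys_iff if_distrib cong: if_cong)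

abbreviation fp_pow_var :: "nat \<Rightarrow> rat \<Rightarrow> ('k :: alg_closed_field) frac_poly" where
  "fp_pow_var j r \<equiv> Poly_Mapping.single (Poly_Mapping.single j r) 1"

text \<open>Convolution adds exponents, so the product of the variable powers is the monomial of the
  summed exponents. It reduces a homomorphism to its values on constants and on fractional powers of
  single variables.\<close>

lemma single_monom_eq_prod:
  "Poly_Mapping.single \<mu> (c :: 'k :: alg_closed_field) =
     const_poly c * (\<Prod>j\<in>Poly_Mapping.keys \<mu>. fp_pow_var j (Poly_Mapping.lookup \<mu> j))"
proof -
  have "(\<Prod>j\<in>A. fp_pow_var j (g j)) = Poly_Mapping.single (\<Sum>j\<in>A. Poly_Mapping.single j (g j)) (1 :: 'k)"
    for A g
    by (induction A rule: infinite_finite_induct) (simp_all add: mult_single)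
  then show ?thesis
    by (simp add: const_poly_def mult_single flip: poly_mapping_eq_sum_single)
qed

section \<open>Closure properties of \<open>frac_polys\<close>\<close>

lemma frac_polys_0 [simp]: "0 \<in> frac_polys n"
  by (simp add: frac_polys_def)

lemma frac_polys_add: "f \<in> frac_polys n \<Longrightarrow> g \<in> frac_polys n \<Longrightarrow> f + g \<in> frac_polys n"
  using keys_add[of f g] unfolding frac_polys_def by blast

lemma frac_polys_sum: "(\<And>a. a \<in> A \<Longrightarrow> f a \<in> frac_polys n) \<Longrightarrow> sum f A \<in> frac_polys n"
  by (induction A rule: infinite_finite_induct) (auto intro: frac_polys_add)

lemma frac_polys_uminus: "f \<in> frac_polys n \<Longrightarrow> - f \<in> frac_polys n"
  by (simp add: frac_polys_def in_keys_iff)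

lemma frac_polys_diff: "f \<in> frac_polys n \<Longrightarrow> g \<in> frac_polys n \<Longrightarrow> f - g \<in> frac_polys n"
  using frac_polys_add[of f n "- g"] frac_polys_uminus[of g n] by simp

lemma const_poly_in_frac_polys [simp]: "const_poly c \<in> frac_polys n"
  by (simp add: frac_polys_def const_poly_def)

lemma frac_polys_1 [simp]: "1 \<in> frac_polys n"
  using const_poly_in_frac_polys[of 1 n] by (simp add: const_poly_def)

lemma fp_pow_var_in_frac_polys:
  assumes "j < n" "r \<in> zinvp_nonneg CHAR('k :: alg_closed_field)"
  shows "(fp_pow_var j r :: 'k frac_poly) \<in> frac_polys n"
  using assms by (auto simp: frac_polys_def lookup_single when_def)

context
  assumes char_pos: "CHAR('k :: alg_closed_field) > 0"
begin

text \<open>A key of the product is a sum of a key of \<open>f\<close> and a key of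
  \<open>g\<close>, and the admissible exponents are closed under addition.\<close>

lemma frac_polys_mult:
  assumes f: "(f :: 'k frac_poly) \<in> frac_polys n" and g: "g \<in> frac_polys n"
  shows "f * g \<in> frac_polys n"
  unfolding frac_polys_def
proof (intro CollectI ballI)
  fix \<mu> assume "\<mu> \<in> Poly_Mapping.keys (f * g)"
  then obtain \<alpha> \<beta> where ab: "\<mu> = \<alpha> + \<beta>" "\<alpha> \<in> Poly_Mapping.keys f" "\<beta> \<in> Poly_Mapping.keys g"
    using keys_mult[of f g] by blast
  have "Poly_Mapping.keys \<mu> \<subseteq> {..<n}"
    using f g ab(2,3) keys_add[of \<alpha> \<beta>] unfolding ab(1) frac_polys_def by blast
  moreover have "Poly_Mapping.lookup \<mu> j \<in> zinvp_nonneg CHAR('k)" for j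
    using f g ab(2,3) zinvp_nonneg_add[OF char_pos] unfolding ab(1) frac_polys_def lookup_add by blast
  ultimately show "Poly_Mapping.keys \<mu> \<subseteq> {..<n} \<and>
      (\<forall>j. Poly_Mapping.lookup \<mu> j \<in> zinvp_nonneg CHAR('k))" by blast
qed

lemma frac_polys_prod:
  "(\<And>a. a \<in> A \<Longrightarrow> (f a :: 'k frac_poly) \<in> frac_polys n) \<Longrightarrow> prod f A \<in> frac_polys n"
  by (induction A rule: infinite_finite_induct) (auto intro: frac_polys_mult)

lemma frac_polys_power: "(f :: 'k frac_poly) \<in> frac_polys n \<Longrightarrow> f ^ a \<in> frac_polys n"
  by (induction a) (auto intro: frac_polys_mult)

section \<open>Multiplicativity of evaluation\<close>

lemma eval_monom_superset:
  assumes "finite A" "Poly_Mapping.keys \<mu> \<subseteq> A"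
  shows "eval_monom \<mu> (x :: nat \<Rightarrow> 'k) = (\<Prod>j\<in>A. frac_pow (x j) (Poly_Mapping.lookup \<mu> j))"
  unfolding eval_monom_def
  by (rule prod.mono_neutral_left) (use assms in \<open>auto simp: in_keys_iff frac_pow_0[OF char_pos]\<close>)

lemma eval_monom_add:
  assumes "\<And>j. Poly_Mapping.lookup \<mu> j \<in> zinvp_nonneg CHAR('k)"
    and "\<And>j. Poly_Mapping.lookup \<nu> j \<in> zinvp_nonneg CHAR('k)"
  shows "eval_monom (\<mu> + \<nu>) (x :: nat \<Rightarrow> 'k) = eval_monom \<mu> x * eval_monom \<nu> x"
proof -
  let ?A = "Poly_Mapping.keys \<mu> \<union> Poly_Mapping.keys \<nu>"
  have "eval_monom (\<mu> + \<nu>) x = (\<Prod>j\<in>?A. frac_pow (x j) (Poly_Mapping.lookup (\<mu> + \<nu>) j))"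
    using keys_add[of \<mu> \<nu>] by (intro eval_monom_superset) auto
  also have "\<dots> = (\<Prod>j\<in>?A. frac_pow (x j) (Poly_Mapping.lookup \<mu> j)) *
      (\<Prod>j\<in>?A. frac_pow (x j) (Poly_Mapping.lookup \<nu> j))"
    by (simp add: lookup_add frac_pow_add[OF char_pos assms] prod.distrib)
  also have "\<dots> = eval_monom \<mu> x * eval_monom \<nu> x"
    by (simp add: eval_monom_superset[of ?A])
  finally show ?thesis .
qed

text \<open>Bilinear expansion reduces the claim to two monomials, where it is the addition rule for
  exponents. Membership in \<open>frac_polys\<close> supplies the exponents for which that rule is
  available.\<close>

lemma eval_fp_mult:
  assumes f: "(f :: 'k frac_poly) \<in> frac_polys n" and g: "g \<in> frac_polys n"
  shows "eval_fp (f * g) x = eval_fp f x * eval_fp g x"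
proof -
  let ?s = "\<lambda>f \<mu>. Poly_Mapping.single \<mu> (Poly_Mapping.lookup f \<mu>)"
  have "f * g = (\<Sum>\<mu>\<in>Poly_Mapping.keys f. ?s f \<mu>) * (\<Sum>\<nu>\<in>Poly_Mapping.keys g. ?s g \<nu>)"
    by (simp flip: poly_mapping_eq_sum_single)
  then have "eval_fp (f * g) x =
      (\<Sum>\<mu>\<in>Poly_Mapping.keys f. \<Sum>\<nu>\<in>Poly_Mapping.keys g. eval_fp (?s f \<mu> * ?s g \<nu>) x)"
    by (simp add: sum_product eval_fp_sum)
  also have "\<dots> = (\<Sum>\<mu>\<in>Poly_Mapping.keys f. \<Sum>\<nu>\<in>Poly_Mapping.keys g.
      (Poly_Mapping.lookup f \<mu> * eval_monom \<mu> x) * (Poly_Mapping.lookup g \<nu> * eval_monom \<nu> x))"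
  proof (intro sum.cong refl)
    fix \<mu> \<nu> assume "\<mu> \<in> Poly_Mapping.keys f" "\<nu> \<in> Poly_Mapping.keys g"
    then have "eval_monom (\<mu> + \<nu>) x = eval_monom \<mu> x * eval_monom \<nu> x"
      using f g unfolding frac_polys_def by (intro eval_monom_add) auto
    then show "eval_fp (?s f \<mu> * ?s g \<nu>) x =
        (Poly_Mapping.lookup f \<mu> * eval_monom \<mu> x) * (Poly_Mapping.lookup g \<nu> * eval_monom \<nu> x)"
      by (simp add: mult_single eval_fp_single)
  qed
  also have "\<dots> = eval_fp f x * eval_fp g x"
    by (simp add: eval_fp_superset[of "Poly_Mapping.keys f" f] eval_fp_superset[of "Poly_Mapping.keys g" g]
        sum_product)
  finally show ?thesis .
qed

lemma eval_fp_pow_var: "eval_fp (fp_pow_var j r) (x :: nat \<Rightarrow> 'k) = frac_pow (x j) r"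
  \<comment> \<open>For \<open>r = 0\<close> the monomial has no keys, and the empty product has to
    agree with \<open>frac_pow (x j) 0\<close>.\<close>
  by (cases "r = 0") (simp_all add: eval_fp_single eval_monom_def frac_pow_0[OF char_pos])

lemma frac_poly_ring_cring: "cring (frac_poly_ring n :: 'k frac_poly ring)"
proof (rule cringI)
  show "abelian_group (frac_poly_ring n :: 'k frac_poly ring)"
  proof (rule abelian_groupI)
    fix f :: "'k frac_poly" assume "f \<in> carrier (frac_poly_ring n)"
    then show "\<exists>g\<in>carrier (frac_poly_ring n). g \<oplus>\<^bsub>frac_poly_ring n\<^esub> f = \<zero>\<^bsub>frac_poly_ring n\<^esub>"
      by (intro bexI[of _ "- f"]) (simp_all add: frac_poly_ring_def frac_polys_uminus)
  qed (simp_all add: frac_poly_ring_def frac_polys_add ac_simps)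
  show "comm_monoid (frac_poly_ring n :: 'k frac_poly ring)"
    by (rule comm_monoidI) (simp_all add: frac_poly_ring_def frac_polys_mult ac_simps)
qed (simp add: frac_poly_ring_def distrib_right)


subsection \<open>Coordinate rings\<close>

lemma vanishing_ideal_ideal:
  fixes V :: "(nat \<Rightarrow> 'k) set"
  shows "ideal (vanishing_ideal n V) (frac_poly_ring n)"
proof -
  interpret R: cring "frac_poly_ring n :: 'k frac_poly ring" by (rule frac_poly_ring_cring)
  \<comment> \<open>The subgroup condition speaks of the inverse in \<open>add_monoid\<close>, which
    must first be identified with unary minus.\<close>
  have inv: "inv\<^bsub>add_monoid (frac_poly_ring n)\<^esub> f = - f"
    if "(f :: 'k frac_poly) \<in> frac_polys n" for f
    using that R.minus_equality[of "- f" f] frac_polys_uminus[OF that]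
    unfolding a_inv_def by (simp add: frac_poly_ring_def)
  show ?thesis
  proof (rule idealI)
    show "subgroup (vanishing_ideal n V) (add_monoid (frac_poly_ring n))"
    proof (rule group.subgroupI[OF R.a_group])
      have "0 \<in> vanishing_ideal n V" by (simp add: vanishing_ideal_def)
      then show "vanishing_ideal n V \<noteq> {}" by blast
      show "inv\<^bsub>add_monoid (frac_poly_ring n)\<^esub> f \<in> vanishing_ideal n V"
        if "f \<in> vanishing_ideal n V" for f
        using that inv[of f] frac_polys_uminus[of f n]
        unfolding vanishing_ideal_def by (simp only: mem_Collect_eq) (simp add: eval_fp_uminus)
    qed (auto simp: vanishing_ideal_def frac_poly_ring_def frac_polys_add eval_fp_add)
  qed (auto simp: vanishing_ideal_def frac_poly_ring_def frac_polys_mult eval_fp_mult R.ring_axioms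
      intro: R.ring_axioms[unfolded frac_poly_ring_def])
qed

end

section \<open>Residue classes as functions on V\<close>

abbreviation coord_class ::
    "nat \<Rightarrow> (nat \<Rightarrow> 'k :: alg_closed_field) set \<Rightarrow> 'k frac_poly \<Rightarrow> 'k frac_poly set" where
  "coord_class n V f \<equiv> vanishing_ideal n V +>\<^bsub>frac_poly_ring n\<^esub> f"

lemma coord_class_eq: "coord_class n V f = (\<lambda>h. h + f) ` vanishing_ideal n V"
  by (auto simp: a_r_coset_def r_coset_def frac_poly_ring_def)

text \<open>Members of the class differ from \<open>f\<close> by polynomials vanishing at
  \<open>x\<close>, and \<open>f\<close> itself is a member. So the set of values is a singleton and
  \<open>the_elem\<close> returns its element.\<close>

lemma coord_fun_class:
  assumes "x \<in> V"
  shows "coord_fun V (coord_class n V f) x = eval_fp f x"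
proof -
  have "(\<lambda>f. eval_fp f x) ` coord_class n V f = {eval_fp f x}"
  proof (intro equalityI subsetI)
    have "0 \<in> vanishing_ideal n V" by (simp add: vanishing_ideal_def)
    then have "f \<in> coord_class n V f" unfolding coord_class_eq by force
    then show "y \<in> (\<lambda>f. eval_fp f x) ` coord_class n V f" if "y \<in> {eval_fp f x}" for y
      using that by blast
  qed (use assms in \<open>auto simp: coord_class_eq eval_fp_add\<close>,
        simp add: vanishing_ideal_def)
  then show ?thesis using assms by (simp add: coord_fun_def)
qed

lemma carrier_coord_ring: "carrier (coord_ring n V) = coord_class n V ` frac_polys n"
  by (auto simp: coord_ring_def FactRing_def A_RCOSETS_def' frac_poly_ring_def)

lemma coord_class_in_carrier: "f \<in> frac_polys n \<Longrightarrow> coord_class n V f \<in> carrier (coord_ring n V)"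
  by (simp add: carrier_coord_ring)

text \<open>The difference \<open>f - g\<close> lies in the vanishing ideal, so \<open>u + f\<close>
  can be rewritten as \<open>u + (f - g) + g\<close>. The reverse inclusion follows by
  symmetry.\<close>

lemma coord_class_eqI:
  assumes "f \<in> frac_polys n" "g \<in> frac_polys n" "\<And>x. x \<in> V \<Longrightarrow> eval_fp f x = eval_fp g x"
  shows "coord_class n V f = coord_class n V g"
proof -
  have *: "coord_class n V f \<subseteq> coord_class n V g"
    if "f \<in> frac_polys n" "g \<in> frac_polys n" "\<And>x. x \<in> V \<Longrightarrow> eval_fp f x = eval_fp g x" for f g
  proof
    fix h assume "h \<in> coord_class n V f"
    then obtain u where u: "u \<in> vanishing_ideal n V" "h = u + f" unfolding coord_class_eq by blast
    have "u + (f - g) \<in> vanishing_ideal n V"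
      using u(1) that
      by (auto simp: vanishing_ideal_def eval_fp_add eval_fp_diff intro: frac_polys_add frac_polys_diff)
    moreover have "h = u + (f - g) + g" using u(2) by (simp add: algebra_simps)
    ultimately show "h \<in> coord_class n V g" unfolding coord_class_eq by blast
  qed
  show ?thesis using *[of f g] *[of g f] assms by auto
qed

text \<open>The ideal contains every polynomial that vanishes on V, so a class is determined by its
  function. This gives meaning to the inverse of \<open>coord_fun\<close> in \<open>pullback\<close>
  and allows equality in the coordinate ring to be checked pointwise.\<close>

lemma coord_fun_inj: "inj_on (coord_fun V) (carrier (coord_ring n V))"
proof (rule inj_onI)
  fix a b assume "a \<in> carrier (coord_ring n V)" "b \<in> carrier (coord_ring n V)"
    and eq: "coord_fun V a = coord_fun V b"
  then obtain f g where fg: "f \<in> frac_polys n" "a = coord_class n V f"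
      "g \<in> frac_polys n" "b = coord_class n V g"
    unfolding carrier_coord_ring by blast
  have "eval_fp f x = eval_fp g x" if "x \<in> V" for x
    using eq coord_fun_class[OF that, of n f] coord_fun_class[OF that, of n g]
    unfolding fg by simp
  then show "a = b" unfolding fg using fg by (intro coord_class_eqI) auto
qed

lemma coord_ring_eqI:
  assumes "a \<in> carrier (coord_ring n V)" "b \<in> carrier (coord_ring n V)"
    and "\<And>x. x \<in> V \<Longrightarrow> coord_fun V a x = coord_fun V b x"
  shows "a = b"
proof (rule inj_onD[OF coord_fun_inj _ assms(1,2)])
  show "coord_fun V a = coord_fun V b"
  proof
    \<comment> \<open>Outside \<open>V\<close> both functions are \<open>undefined\<close> by
      restriction.\<close>
    fix x show "coord_fun V a x = coord_fun V b x"
      using assms(3) by (cases "x \<in> V") (simp_all add: coord_fun_def)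
  qed
qed

context
  assumes char_pos: "CHAR('k :: alg_closed_field) > 0"
begin

section \<open>Ring operations on classes and on their functions\<close>

lemma coord_class_ring_hom:
  fixes V :: "(nat \<Rightarrow> 'k) set"
  shows "coord_class n V \<in> ring_hom (frac_poly_ring n) (coord_ring n V)"
  unfolding coord_ring_def by (rule ideal.rcos_ring_hom[OF vanishing_ideal_ideal[OF char_pos]])

lemma coord_class_mult:
  fixes V :: "(nat \<Rightarrow> 'k) set"
  assumes "f \<in> frac_polys n" "g \<in> frac_polys n"
  shows "coord_class n V f \<otimes>\<^bsub>coord_ring n V\<^esub> coord_class n V g = coord_class n V (f * g)"
  using ring_hom_mult[OF coord_class_ring_hom, of f n g V] assms
  by (simp add: frac_poly_ring_def)

lemma coord_class_add:
  fixes V :: "(nat \<Rightarrow> 'k) set"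
  assumes "f \<in> frac_polys n" "g \<in> frac_polys n"
  shows "coord_class n V f \<oplus>\<^bsub>coord_ring n V\<^esub> coord_class n V g = coord_class n V (f + g)"
  using ring_hom_add[OF coord_class_ring_hom, of f n g V] assms
  by (simp add: frac_poly_ring_def)

lemma coord_class_one:
  fixes V :: "(nat \<Rightarrow> 'k) set"
  shows "\<one>\<^bsub>coord_ring n V\<^esub> = coord_class n V 1"
  using ring_hom_one[OF coord_class_ring_hom, of n V] by (simp add: frac_poly_ring_def)

lemma coord_ring_closed:
  fixes V :: "(nat \<Rightarrow> 'k) set"
  assumes "a \<in> carrier (coord_ring n V)" "b \<in> carrier (coord_ring n V)"
  shows "a \<otimes>\<^bsub>coord_ring n V\<^esub> b \<in> carrier (coord_ring n V)"
    and "a \<oplus>\<^bsub>coord_ring n V\<^esub> b \<in> carrier (coord_ring n V)"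
  using assms unfolding carrier_coord_ring
  by (auto simp: coord_class_mult coord_class_add intro!: imageI frac_polys_mult[OF char_pos] frac_polys_add)

lemma coord_fun_mult:
  fixes V :: "(nat \<Rightarrow> 'k) set"
  assumes "a \<in> carrier (coord_ring n V)" "b \<in> carrier (coord_ring n V)" "x \<in> V"
  shows "coord_fun V (a \<otimes>\<^bsub>coord_ring n V\<^esub> b) x = coord_fun V a x * coord_fun V b x"
  using assms unfolding carrier_coord_ring
  by (auto simp: coord_class_mult coord_fun_class eval_fp_mult[OF char_pos])

lemma coord_fun_add:
  fixes V :: "(nat \<Rightarrow> 'k) set"
  assumes "a \<in> carrier (coord_ring n V)" "b \<in> carrier (coord_ring n V)" "x \<in> V"
  shows "coord_fun V (a \<oplus>\<^bsub>coord_ring n V\<^esub> b) x = coord_fun V a x + coord_fun V b x"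
  using assms unfolding carrier_coord_ring
  by (auto simp: coord_class_add coord_fun_class eval_fp_add)


subsection \<open>Composition of polynomial functions\<close>

text \<open>Agreement is demanded at every family \<open>x\<close>, not only on some V, so closure
  properties can be proved for functions without reference to an algebraic set.\<close>

definition representable :: "nat \<Rightarrow> ((nat \<Rightarrow> 'a) \<Rightarrow> 'a :: alg_closed_field) \<Rightarrow> bool" where
  "representable n h \<longleftrightarrow> (\<exists>f\<in>frac_polys n. \<forall>x. eval_fp f x = h x)"

lemma representable_eval: "f \<in> frac_polys n \<Longrightarrow> representable n (eval_fp f)"
  by (auto simp: representable_def)

lemma representable_const: "representable n (\<lambda>x. c)"
  unfolding representable_def by (intro bexI[of _ "const_poly c"]) simp_all

lemma representable_frac_pow_var:
  "j < n \<Longrightarrow> r \<in> zinvp_nonneg CHAR('k) \<Longrightarrow> representable n (\<lambda>x :: nat \<Rightarrow> 'k. frac_pow (x j) r)"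
  unfolding representable_def
  by (intro bexI[of _ "fp_pow_var j r"]) (simp_all add: eval_fp_pow_var[OF char_pos] fp_pow_var_in_frac_polys)

lemma representable_add:
  "representable n f \<Longrightarrow> representable n g \<Longrightarrow> representable n (\<lambda>x. f x + g x)"
  unfolding representable_def by (metis eval_fp_add frac_polys_add)

lemma representable_mult:
  "representable n f \<Longrightarrow> representable n g \<Longrightarrow> representable n (\<lambda>x :: nat \<Rightarrow> 'k. f x * g x)"
  unfolding representable_def by (metis eval_fp_mult[OF char_pos] frac_polys_mult[OF char_pos])

lemma representable_sum:
  "(\<And>a. a \<in> A \<Longrightarrow> representable n (f a)) \<Longrightarrow> representable n (\<lambda>x. \<Sum>a\<in>A. f a x)"
  by (induction A rule: infinite_finite_induct) (auto intro: representable_add representable_const)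

lemma representable_prod:
  "(\<And>a. a \<in> A \<Longrightarrow> representable n (f a)) \<Longrightarrow> representable n (\<lambda>x :: nat \<Rightarrow> 'k. \<Prod>a\<in>A. f a x)"
  by (induction A rule: infinite_finite_induct) (auto intro: representable_mult representable_const)

lemma representable_power:
  "representable n f \<Longrightarrow> representable n (\<lambda>x :: nat \<Rightarrow> 'k. f x ^ a)"
  by (induction a) (auto intro: representable_mult representable_const)

text \<open>The root passes through sums and products: each coefficient is replaced by its root and
  each exponent is divided by \<open>p^i\<close>. The result is again a polynomial with admissible
  exponents.\<close>

lemma representable_frob_root:
  assumes "representable n h"
  shows "representable n (\<lambda>x :: nat \<Rightarrow> 'k. frob_root i (h x))"
proof -
  obtain f where f: "f \<in> frac_polys n" "\<And>x. h x = eval_fp f x"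
    using assms unfolding representable_def by force
  have "frob_root i (h x) = (\<Sum>\<mu>\<in>Poly_Mapping.keys f. frob_root i (Poly_Mapping.lookup f \<mu>) *
      (\<Prod>j\<in>Poly_Mapping.keys \<mu>. frac_pow (x j) (Poly_Mapping.lookup \<mu> j / of_nat (CHAR('k) ^ i))))" for x
    unfolding f(2) eval_fp_def frob_root_sum[OF char_pos] frob_root_mult[OF char_pos]
      frob_root_prod[OF char_pos]
    using f(1) by (intro sum.cong arg_cong2[where f = "(*)"] prod.cong frob_root_frac_pow[OF char_pos] refl)
      (auto simp: frac_polys_def)
  moreover have "representable n (\<lambda>x. \<Sum>\<mu>\<in>Poly_Mapping.keys f. frob_root i (Poly_Mapping.lookup f \<mu>) *
      (\<Prod>j\<in>Poly_Mapping.keys \<mu>. frac_pow (x j) (Poly_Mapping.lookup \<mu> j / of_nat (CHAR('k) ^ i))))"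
    using f(1)
    by (intro representable_sum representable_mult representable_const representable_prod
        representable_frac_pow_var zinvp_nonneg_divide) (auto simp: frac_polys_def)
  ultimately show ?thesis by simp
qed

lemma representable_frac_pow:
  assumes "representable n h" "r \<in> zinvp_nonneg CHAR('k)"
  shows "representable n (\<lambda>x :: nat \<Rightarrow> 'k. frac_pow (h x) r)"
proof -
  obtain a i where r: "r = of_nat a / of_nat (CHAR('k) ^ i)"
    using assms(2) unfolding zinvp_nonneg_def by blast
  show ?thesis unfolding r frac_pow_eq[OF char_pos]
    by (intro representable_power representable_frob_root assms)
qed

text \<open>The value of \<open>g\<close> is built from constants, sums, products and fractional
  powers of its arguments. Each of these operations preserves representability, so polynomials may
  be substituted for the variables.\<close>

lemma eval_fp_compose:
  assumes g: "(g :: 'k frac_poly) \<in> frac_polys m" and P: "\<And>j. j < m \<Longrightarrow> P j \<in> frac_polys n"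
  obtains f where "f \<in> frac_polys n" "\<And>x. eval_fp f x = eval_fp g (\<lambda>j\<in>{..<m}. eval_fp (P j) x)"
proof -
  have mem: "j < m" "Poly_Mapping.lookup \<mu> j \<in> zinvp_nonneg CHAR('k)"
    if "\<mu> \<in> Poly_Mapping.keys g" "j \<in> Poly_Mapping.keys \<mu>" for \<mu> j
    using that g by (auto simp: frac_polys_def)
  have "representable n (\<lambda>x. (\<lambda>j\<in>{..<m}. eval_fp (P j) x) j)" if "j < m" for j
    using that representable_eval[OF P] by simp
  then have "representable n (\<lambda>x. eval_fp g (\<lambda>j\<in>{..<m}. eval_fp (P j) x))"
    unfolding eval_fp_def[of g]
    by (intro representable_sum representable_mult representable_const representable_prod
        representable_frac_pow mem) (simp only: mem)
  then show ?thesis using that unfolding representable_def by blast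
qed

section \<open>Homomorphisms into k as point evaluations\<close>

text \<open>The values at the variables themselves suffice: the value at a root of a variable is
  forced, because roots in k are unique.\<close>

lemma hom_eq_eval:
  fixes \<theta> :: "'k frac_poly \<Rightarrow> 'k"
  assumes add: "\<And>f g. f \<in> frac_polys m \<Longrightarrow> g \<in> frac_polys m \<Longrightarrow> \<theta> (f + g) = \<theta> f + \<theta> g"
    and mult: "\<And>f g. f \<in> frac_polys m \<Longrightarrow> g \<in> frac_polys m \<Longrightarrow> \<theta> (f * g) = \<theta> f * \<theta> g"
    and const: "\<And>c. \<theta> (const_poly c) = c"
    and g: "g \<in> frac_polys m"
  shows "\<theta> g = eval_fp g (\<lambda>j\<in>{..<m}. \<theta> (fp_pow_var j 1))"
proof -
  let ?p = "CHAR('k)" and ?y = "\<lambda>j\<in>{..<m}. \<theta> (fp_pow_var j 1)"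
  \<comment> \<open>The constants 0 and 1 supply the base cases for the sums, products and powers
    below.\<close>
  have zero: "\<theta> 0 = 0" using const[of 0] by (simp add: const_poly_def)
  have one: "\<theta> 1 = 1" using const[of 1] by (simp add: const_poly_def)
  have sum: "\<theta> (sum f A) = (\<Sum>a\<in>A. \<theta> (f a))"
    if "\<And>a. a \<in> A \<Longrightarrow> f a \<in> frac_polys m" for f and A :: "(nat \<Rightarrow>\<^sub>0 rat) set"
    using that by (induction A rule: infinite_finite_induct) (auto simp: zero add frac_polys_sum)
  have prod: "\<theta> (prod f A) = (\<Prod>a\<in>A. \<theta> (f a))"
    if "\<And>a. a \<in> A \<Longrightarrow> f a \<in> frac_polys m" for f and A :: "nat set"
    using that
    by (induction A rule: infinite_finite_induct) (auto simp: one mult frac_polys_prod[OF char_pos])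
  have power: "\<theta> (f ^ a) = \<theta> f ^ a" if "f \<in> frac_polys m" for f a
    using that by (induction a) (auto simp: one mult frac_polys_power[OF char_pos])
  have var_power: "fp_pow_var j r ^ a = (fp_pow_var j (of_nat a * r) :: 'k frac_poly)" for j r a
    by (induction a) (simp_all add: mult_single distrib_right flip: single_add)
  have var: "\<theta> (fp_pow_var j r) = frac_pow (?y j) r"
    if j: "j < m" and r: "r \<in> zinvp_nonneg ?p" for j r
  proof -
    obtain a i where ai: "r = of_nat a / of_nat (?p ^ i)"
      using r unfolding zinvp_nonneg_def by blast
    have "\<theta> (fp_pow_var j r) ^ (?p ^ i) = \<theta> (fp_pow_var j r ^ (?p ^ i))"
      using power fp_pow_var_in_frac_polys[OF j r] by simp
    \<comment> \<open>Both sides are the variable with the integral exponent \<open>a\<close>, since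
      the denominator of \<open>r\<close> cancels.\<close>
    also have "fp_pow_var j r ^ (?p ^ i) = (fp_pow_var j 1 ^ a :: 'k frac_poly)"
      unfolding var_power ai using char_pos by simp
    also have "\<theta> (fp_pow_var j 1 ^ a) = ?y j ^ a"
      using power fp_pow_var_in_frac_polys[OF j zinvp_nonneg_1] j by simp
    finally show ?thesis unfolding ai by (rule frac_pow_eqI[OF char_pos, symmetric])
  qed
  have mem: "\<And>j. j \<in> Poly_Mapping.keys \<mu> \<Longrightarrow> j < m" "\<And>j. Poly_Mapping.lookup \<mu> j \<in> zinvp_nonneg ?p"
    if "\<mu> \<in> Poly_Mapping.keys g" for \<mu>
    using that g by (auto simp: frac_polys_def)
  have prod_mem: "(\<Prod>j\<in>Poly_Mapping.keys \<mu>. fp_pow_var j (Poly_Mapping.lookup \<mu> j)) \<in> (frac_polys m :: 'k frac_poly set)"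
    if "\<mu> \<in> Poly_Mapping.keys g" for \<mu>
    using mem[OF that] by (intro frac_polys_prod[OF char_pos] fp_pow_var_in_frac_polys)
  have monom: "\<theta> (Poly_Mapping.single \<mu> c) = c * (\<Prod>j\<in>Poly_Mapping.keys \<mu>. frac_pow (?y j) (Poly_Mapping.lookup \<mu> j))"
    if \<mu>: "\<mu> \<in> Poly_Mapping.keys g" for \<mu> c
  proof -
    have "\<theta> (Poly_Mapping.single \<mu> c) =
        c * \<theta> (\<Prod>j\<in>Poly_Mapping.keys \<mu>. fp_pow_var j (Poly_Mapping.lookup \<mu> j))"
      unfolding single_monom_eq_prod[of \<mu> c]
      using mult[OF const_poly_in_frac_polys prod_mem[OF \<mu>]] by (simp add: const)
    also have "\<theta> (\<Prod>j\<in>Poly_Mapping.keys \<mu>. fp_pow_var j (Poly_Mapping.lookup \<mu> j)) =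
        (\<Prod>j\<in>Poly_Mapping.keys \<mu>. \<theta> (fp_pow_var j (Poly_Mapping.lookup \<mu> j)))"
      using mem[OF \<mu>] by (intro prod fp_pow_var_in_frac_polys)
    also have "\<dots> = (\<Prod>j\<in>Poly_Mapping.keys \<mu>. frac_pow (?y j) (Poly_Mapping.lookup \<mu> j))"
      using mem[OF \<mu>] by (intro prod.cong refl var)
    finally show ?thesis .
  qed
  have "\<theta> g = \<theta> (\<Sum>\<mu>\<in>Poly_Mapping.keys g. Poly_Mapping.single \<mu> (Poly_Mapping.lookup g \<mu>))"
    by (simp flip: poly_mapping_eq_sum_single)
  also have "\<dots> = (\<Sum>\<mu>\<in>Poly_Mapping.keys g. \<theta> (Poly_Mapping.single \<mu> (Poly_Mapping.lookup g \<mu>)))"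
  proof (rule sum)
    show "Poly_Mapping.single \<mu> (Poly_Mapping.lookup g \<mu>) \<in> frac_polys m"
      if "\<mu> \<in> Poly_Mapping.keys g" for \<mu>
      using that g by (auto simp: frac_polys_def)
  qed
  also have "\<dots> = eval_fp g ?y" unfolding eval_fp_def by (intro sum.cong refl monom)
  finally show ?thesis .
qed


subsection \<open>Pullbacks\<close>

text \<open>As \<open>pullback\<close> is defined by inverting \<open>coord_fun\<close>, the point
  is that the composed function lies in its range. A representative of \<open>g\<close> composed
  with polynomials for \<open>\<phi>\<close> gives the required class.\<close>

lemma pullback_coord_fun:
  fixes V W :: "(nat \<Rightarrow> 'k) set"
  assumes \<phi>: "\<phi> \<in> polynomial_maps n V m W" and g: "g \<in> carrier (coord_ring m W)"
  shows "pullback n V m W \<phi> g \<in> carrier (coord_ring n V)"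
    and "coord_fun V (pullback n V m W \<phi> g) = compose V (coord_fun W g) \<phi>"
proof -
  obtain h where h: "h \<in> frac_polys m" "g = coord_class m W h"
    using g unfolding carrier_coord_ring by blast
  obtain P where P: "\<And>j. j < m \<Longrightarrow> P j \<in> frac_polys n"
      "\<And>x. x \<in> V \<Longrightarrow> \<phi> x = (\<lambda>j\<in>{..<m}. eval_fp (P j) x)" and maps: "\<phi> \<in> V \<rightarrow> W"
    using \<phi> unfolding polynomial_maps_def by (auto simp: PiE_def)
  obtain f where f: "f \<in> frac_polys n" "\<And>x. eval_fp f x = eval_fp h (\<lambda>j\<in>{..<m}. eval_fp (P j) x)"
    using eval_fp_compose[of h m P n] h(1) P(1) by blast
  have "coord_fun V (coord_class n V f) = compose V (coord_fun W g) \<phi>"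
  proof
    fix x
    show "coord_fun V (coord_class n V f) x = compose V (coord_fun W g) \<phi> x"
    proof (cases "x \<in> V")
      case True
      then have "\<phi> x \<in> W" using maps by blast
      with True show ?thesis by (simp add: compose_def coord_fun_class h(2) f(2) P(2))
    next
      case False
      then show ?thesis by (simp add: coord_fun_def compose_def)
    qed
  qed
  then have mem: "compose V (coord_fun W g) \<phi> \<in> coord_fun V ` carrier (coord_ring n V)"
    using coord_class_in_carrier[OF f(1), of V] by (metis imageI)
  show "pullback n V m W \<phi> g \<in> carrier (coord_ring n V)"
    using the_inv_into_into[OF coord_fun_inj mem subset_refl] g by (simp add: pullback_def)
  show "coord_fun V (pullback n V m W \<phi> g) = compose V (coord_fun W g) \<phi>"
    using f_the_inv_into_f[OF coord_fun_inj mem] g by (simp add: pullback_def)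
qed

lemma polynomial_maps_funcset: "\<phi> \<in> polynomial_maps n V m W \<Longrightarrow> \<phi> \<in> V \<rightarrow> W"
  by (auto simp: polynomial_maps_def PiE_def)

lemma pullback_apply:
  fixes V W :: "(nat \<Rightarrow> 'k) set"
  assumes "\<phi> \<in> polynomial_maps n V m W" "g \<in> carrier (coord_ring m W)" "x \<in> V"
  shows "coord_fun V (pullback n V m W \<phi> g) x = coord_fun W g (\<phi> x)"
  using pullback_coord_fun(2)[OF assms(1,2)] assms(3) by (simp add: compose_def)

text \<open>Replaces the definition of \<open>pullback\<close> from here on: an element of the
  coordinate ring with the right values on V is the pullback.\<close>

lemma pullback_eqI:
  fixes V W :: "(nat \<Rightarrow> 'k) set"
  assumes "\<phi> \<in> polynomial_maps n V m W" "g \<in> carrier (coord_ring m W)"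
    and "a \<in> carrier (coord_ring n V)" "\<And>x. x \<in> V \<Longrightarrow> coord_fun V a x = coord_fun W g (\<phi> x)"
  shows "pullback n V m W \<phi> g = a"
  using assms by (intro coord_ring_eqI[of _ n V]) (auto simp: pullback_coord_fun(1) pullback_apply)

text \<open>Addition, multiplication and constants are pointwise on functions, and composing with
  \<open>\<phi>\<close> respects pointwise operations.\<close>

lemma pullback_k_algebra_hom:
  fixes V W :: "(nat \<Rightarrow> 'k) set"
  assumes \<phi>: "\<phi> \<in> polynomial_maps n V m W"
  shows "pullback n V m W \<phi> \<in> k_algebra_homs m W n V"
proof -
  note maps = funcset_mem[OF polynomial_maps_funcset[OF \<phi>]]
  have const: "pullback n V m W \<phi> (coord_const m W c) = coord_const n V c" for c
    unfolding coord_const_def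
    by (intro pullback_eqI[OF \<phi>] coord_class_in_carrier) (simp_all add: coord_fun_class maps)
  have "pullback n V m W \<phi> \<in> ring_hom (coord_ring m W) (coord_ring n V)"
  proof (rule ring_hom_memI)
    fix a b assume ab: "a \<in> carrier (coord_ring m W)" "b \<in> carrier (coord_ring m W)"
    show "pullback n V m W \<phi> (a \<otimes>\<^bsub>coord_ring m W\<^esub> b) =
        pullback n V m W \<phi> a \<otimes>\<^bsub>coord_ring n V\<^esub> pullback n V m W \<phi> b"
      using ab by (intro pullback_eqI[OF \<phi>] coord_ring_closed)
        (simp_all add: coord_fun_mult pullback_coord_fun(1)[OF \<phi>] pullback_apply[OF \<phi>] maps)
    show "pullback n V m W \<phi> (a \<oplus>\<^bsub>coord_ring m W\<^esub> b) =
        pullback n V m W \<phi> a \<oplus>\<^bsub>coord_ring n V\<^esub> pullback n V m W \<phi> b"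
      using ab by (intro pullback_eqI[OF \<phi>] coord_ring_closed)
        (simp_all add: coord_fun_add pullback_coord_fun(1)[OF \<phi>] pullback_apply[OF \<phi>] maps)
  next
    show "pullback n V m W \<phi> \<one>\<^bsub>coord_ring m W\<^esub> = \<one>\<^bsub>coord_ring n V\<^esub>"
      unfolding coord_class_one
      by (intro pullback_eqI[OF \<phi>] coord_class_in_carrier) (simp_all add: coord_fun_class maps)
  qed (rule pullback_coord_fun(1)[OF \<phi>])
  then show ?thesis using const by (simp add: k_algebra_homs_def)
qed

lemma polynomial_maps_compose:
  fixes V W U :: "(nat \<Rightarrow> 'k) set"
  assumes \<phi>: "\<phi> \<in> polynomial_maps n V m W" and \<psi>: "\<psi> \<in> polynomial_maps m W l U"
  shows "compose V \<psi> \<phi> \<in> polynomial_maps n V l U"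
proof -
  obtain P where P: "\<And>j. j < m \<Longrightarrow> P j \<in> frac_polys n"
      "\<And>x. x \<in> V \<Longrightarrow> \<phi> x = (\<lambda>j\<in>{..<m}. eval_fp (P j) x)"
    using \<phi> unfolding polynomial_maps_def by blast
  obtain Q where Q: "\<And>j. j < l \<Longrightarrow> Q j \<in> frac_polys m"
      "\<And>x. x \<in> W \<Longrightarrow> \<psi> x = (\<lambda>j\<in>{..<l}. eval_fp (Q j) x)"
    using \<psi> unfolding polynomial_maps_def by blast
  note maps = funcset_mem[OF polynomial_maps_funcset[OF \<phi>]]
    funcset_mem[OF polynomial_maps_funcset[OF \<psi>]]
  \<comment> \<open>The implication is inside the existential so that the statement holds for every
    \<open>j\<close> and yields one choice function \<open>F\<close>.\<close>
  have "\<forall>j. \<exists>f. j < l \<longrightarrow> f \<in> frac_polys n \<and>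
      (\<forall>x. eval_fp f x = eval_fp (Q j) (\<lambda>j\<in>{..<m}. eval_fp (P j) x))"
    using eval_fp_compose[of _ m P n] Q(1) P(1) by metis
  then obtain F where F: "\<And>j. j < l \<Longrightarrow> F j \<in> frac_polys n"
      "\<And>j x. j < l \<Longrightarrow> eval_fp (F j) x = eval_fp (Q j) (\<lambda>j\<in>{..<m}. eval_fp (P j) x)"
    by metis
  have "compose V \<psi> \<phi> x = (\<lambda>j\<in>{..<l}. eval_fp (F j) x)" if "x \<in> V" for x
    using that maps(1)[OF that] F(2) by (auto simp: compose_def Q(2) P(2)[OF that, symmetric] fun_eq_iff)
  moreover have "compose V \<psi> \<phi> \<in> V \<rightarrow>\<^sub>E U"
    using maps by (auto simp: compose_def)
  ultimately show ?thesis using F(1) unfolding polynomial_maps_def by blast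
qed

text \<open>On the coordinate ring of U both sides have the values of \<open>g\<close> after
  \<open>\<psi>\<close> after \<open>\<phi>\<close>. Elsewhere both are \<open>undefined\<close>, so
  they are equal as total functions.\<close>

lemma pullback_compose:
  fixes V W U :: "(nat \<Rightarrow> 'k) set"
  assumes \<phi>: "\<phi> \<in> polynomial_maps n V m W" and \<psi>: "\<psi> \<in> polynomial_maps m W l U"
  shows "pullback n V l U (compose V \<psi> \<phi>) =
    compose (carrier (coord_ring l U)) (pullback n V m W \<phi>) (pullback m W l U \<psi>)"
proof
  fix g
  note maps = funcset_mem[OF polynomial_maps_funcset[OF \<phi>]]
  show "pullback n V l U (compose V \<psi> \<phi>) g =
      compose (carrier (coord_ring l U)) (pullback n V m W \<phi>) (pullback m W l U \<psi>) g"
  proof (cases "g \<in> carrier (coord_ring l U)")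
    case True
    have "pullback n V l U (compose V \<psi> \<phi>) g = pullback n V m W \<phi> (pullback m W l U \<psi> g)"
      using True
      by (intro pullback_eqI polynomial_maps_compose[OF \<phi> \<psi>] pullback_coord_fun(1)[OF \<phi>]
          pullback_coord_fun(1)[OF \<psi>])
        (simp_all add: pullback_apply[OF \<phi>] pullback_apply[OF \<psi>] pullback_coord_fun(1)[OF \<psi>]
          maps compose_def)
    then show ?thesis using True by (simp add: compose_def)
  qed (simp add: pullback_def compose_def)
qed

section \<open>Recovering a polynomial map from its pullback\<close>

lemma coord_fun_var:
  fixes W :: "(nat \<Rightarrow> 'k) set"
  shows "y \<in> W \<Longrightarrow> coord_fun W (coord_class m W (fp_pow_var j 1)) y = y j"
  by (simp add: coord_fun_class eval_fp_pow_var[OF char_pos] frac_pow_1[OF char_pos])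

text \<open>The pullback of the j-th coordinate function has at \<open>x\<close> the j-th coordinate
  of the image point, so equal pullbacks force equal coordinates.\<close>

lemma polynomial_map_eqI:
  fixes V W :: "(nat \<Rightarrow> 'k) set"
  assumes \<phi>: "\<phi> \<in> polynomial_maps n V m W" and \<psi>: "\<psi> \<in> polynomial_maps n V m W"
    and eq: "\<And>g. g \<in> carrier (coord_ring m W) \<Longrightarrow> pullback n V m W \<phi> g = pullback n V m W \<psi> g"
  shows "\<phi> = \<psi>"
proof
  fix x
  show "\<phi> x = \<psi> x"
  proof (cases "x \<in> V")
    case True
    note maps = funcset_mem[OF polynomial_maps_funcset[OF \<phi>] True]
      funcset_mem[OF polynomial_maps_funcset[OF \<psi>] True]
    show ?thesis
    proof
      fix j
      show "\<phi> x j = \<psi> x j"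
      proof (cases "j < m")
        case j: True
        let ?g = "coord_class m W (fp_pow_var j 1 :: 'k frac_poly)"
        have g: "?g \<in> carrier (coord_ring m W)"
          using j by (intro coord_class_in_carrier fp_pow_var_in_frac_polys) simp_all
        show ?thesis
          using pullback_apply[OF \<phi> g True] pullback_apply[OF \<psi> g True] eq[OF g]
          by (simp add: coord_fun_var maps)
      next
        case False
        \<comment> \<open>For \<open>j \<ge> m\<close> both coordinates are
          \<open>undefined\<close>, as image points are restricted to \<open>{..<m}\<close>.\<close>
        then show ?thesis using \<phi> \<psi> True by (auto simp: polynomial_maps_def)
      qed
    qed
  next
    case False
    then show ?thesis using \<phi> \<psi> by (auto simp: polynomial_maps_def PiE_def extensional_def)
  qed
qed

lemma k_algebra_hom_eq_pullback:
  fixes V W :: "(nat \<Rightarrow> 'k) set"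
  assumes W: "algebraic_set m W" and \<Phi>: "\<Phi> \<in> k_algebra_homs m W n V"
  obtains \<phi> where "\<phi> \<in> polynomial_maps n V m W"
    "\<And>g. g \<in> carrier (coord_ring m W) \<Longrightarrow> \<Phi> g = pullback n V m W \<phi> g"
proof -
  have hom: "\<Phi> \<in> ring_hom (coord_ring m W) (coord_ring n V)"
    and const: "\<And>c. \<Phi> (coord_const m W c) = coord_const n V c"
    using \<Phi> by (auto simp: k_algebra_homs_def)
  note closed = ring_hom_closed[OF hom]
  have "\<exists>f. j < m \<longrightarrow> f \<in> frac_polys n \<and> \<Phi> (coord_class m W (fp_pow_var j 1)) = coord_class n V f" for j
    using closed[OF coord_class_in_carrier[OF fp_pow_var_in_frac_polys[of j m 1]]]
    by (auto simp: carrier_coord_ring)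
  then obtain P where P: "\<And>j. j < m \<Longrightarrow> P j \<in> frac_polys n"
      "\<And>j. j < m \<Longrightarrow> \<Phi> (coord_class m W (fp_pow_var j 1)) = coord_class n V (P j)"
    by metis
  \<comment> \<open>The only possible candidate: its coordinates are the functions of the images
    under \<open>\<Phi>\<close> of the coordinate classes.\<close>
  define \<phi> where "\<phi> = (\<lambda>x\<in>V. \<lambda>j\<in>{..<m}. eval_fp (P j) x)"
  have eval: "coord_fun V (\<Phi> (coord_class m W g)) x = eval_fp g (\<phi> x)"
    if x: "x \<in> V" and g: "g \<in> frac_polys m" for x g
  proof -
    \<comment> \<open>The composite of the quotient map, \<open>\<Phi>\<close> and evaluation at
      \<open>x\<close> is a homomorphism into k fixing constants, so it is evaluation at a point,
      which turns out to be \<open>\<phi> x\<close>.\<close>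
    let ?\<theta> = "\<lambda>g. coord_fun V (\<Phi> (coord_class m W g)) x"
    have "?\<theta> g = eval_fp g (\<lambda>j\<in>{..<m}. ?\<theta> (fp_pow_var j 1))"
    proof (rule hom_eq_eval[OF _ _ _ g])
      fix f h :: "'k frac_poly" assume fh: "f \<in> frac_polys m" "h \<in> frac_polys m"
      note fh' = coord_class_in_carrier[OF fh(1), of W] coord_class_in_carrier[OF fh(2), of W]
      show "?\<theta> (f + h) = ?\<theta> f + ?\<theta> h"
        using ring_hom_add[OF hom fh'] coord_fun_add[OF closed[OF fh'(1)] closed[OF fh'(2)] x]
        by (simp add: coord_class_add[OF fh])
      show "?\<theta> (f * h) = ?\<theta> f * ?\<theta> h"
        using ring_hom_mult[OF hom fh'] coord_fun_mult[OF closed[OF fh'(1)] closed[OF fh'(2)] x]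
        by (simp add: coord_class_mult[OF fh])
    next
      show "?\<theta> (const_poly c) = c" for c
        using const[of c] by (simp add: coord_const_def coord_fun_class[OF x])
    qed
    moreover have "(\<lambda>j\<in>{..<m}. ?\<theta> (fp_pow_var j 1)) = \<phi> x"
      using x by (auto simp: \<phi>_def P(2) coord_fun_class)
    ultimately show ?thesis by simp
  qed
  \<comment> \<open>Here algebraicity of \<open>W\<close> enters: membership is tested by equations
    that vanish on \<open>W\<close>, and \<open>\<Phi>\<close> sends their classes to zero.\<close>
  have "\<phi> x \<in> W" if x: "x \<in> V" for x
  proof -
    obtain S where S: "S \<subseteq> frac_polys m" "W = {y \<in> affine_space m. \<forall>f\<in>S. eval_fp f y = 0}"
      using W unfolding algebraic_set_def by blast
    have "eval_fp f (\<phi> x) = 0" if f: "f \<in> S" for f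
    proof -
      \<comment> \<open>The zero class is written as the constant 0, so compatibility of
        \<open>\<Phi>\<close> with constants gives its image.\<close>
      have "coord_class m W f = coord_const m W 0"
        unfolding coord_const_def using S f by (intro coord_class_eqI) auto
      then have "eval_fp f (\<phi> x) = coord_fun V (coord_const n V 0) x"
        using eval[OF x, of f] const[of 0] S(1) f by auto
      then show ?thesis by (simp add: coord_const_def coord_fun_class[OF x])
    qed
    \<comment> \<open>Restriction to \<open>{..<m}\<close> in the definition of
      \<open>\<phi>\<close> places the value in \<open>affine_space m\<close>.\<close>
    then show ?thesis using x by (auto simp: S(2) \<phi>_def affine_space_def)
  qed
  then have \<phi>: "\<phi> \<in> polynomial_maps n V m W"
    unfolding polynomial_maps_def using P(1)
    by (auto simp: \<phi>_def intro!: exI[of _ P])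
  have "\<Phi> g = pullback n V m W \<phi> g" if g: "g \<in> carrier (coord_ring m W)" for g
  proof (rule pullback_eqI[OF \<phi> g closed[OF g], symmetric])
    obtain h where h: "h \<in> frac_polys m" "g = coord_class m W h"
      using g unfolding carrier_coord_ring by blast
    show "coord_fun V (\<Phi> g) x = coord_fun W g (\<phi> x)" if x: "x \<in> V" for x
      using eval[OF x h(1)] coord_fun_class[of "\<phi> x" W m h] funcset_mem[OF polynomial_maps_funcset[OF \<phi>] x]
      by (simp add: h(2))
  qed
  with \<phi> show ?thesis by (rule that)
qed

end

theorem mainTheorem4:
  fixes V W U :: "(nat \<Rightarrow> 'k :: alg_closed_field) set" and n m l :: nat
  assumes "CHAR('k) > 0"
    and "algebraic_set n V" and "algebraic_set m W" and "algebraic_set l U"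
  shows
    "(\<forall>\<phi>\<in>polynomial_maps n V m W.
        (\<forall>g\<in>carrier (coord_ring m W).
           pullback n V m W \<phi> g \<in> carrier (coord_ring n V) \<and>
           coord_fun V (pullback n V m W \<phi> g) = compose V (coord_fun W g) \<phi>) \<and>
        pullback n V m W \<phi> \<in> k_algebra_homs m W n V) \<and>
     (\<forall>\<phi>\<in>polynomial_maps n V m W. \<forall>\<psi>\<in>polynomial_maps m W l U.
        pullback n V l U (compose V \<psi> \<phi>) =
          compose (carrier (coord_ring l U)) (pullback n V m W \<phi>) (pullback m W l U \<psi>)) \<and>
     (\<forall>\<Phi>\<in>k_algebra_homs m W n V. \<exists>!\<phi>. \<phi> \<in> polynomial_maps n V m W \<and>
        (\<forall>g\<in>carrier (coord_ring m W). \<Phi> g = pullback n V m W \<phi> g))"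
proof (intro conjI ballI)
  fix \<Phi> assume \<Phi>: "\<Phi> \<in> k_algebra_homs m W n V"
  obtain \<phi> where \<phi>: "\<phi> \<in> polynomial_maps n V m W"
      "\<And>g. g \<in> carrier (coord_ring m W) \<Longrightarrow> \<Phi> g = pullback n V m W \<phi> g"
    using k_algebra_hom_eq_pullback[OF assms(1,3) \<Phi>] by blast
  show "\<exists>!\<phi>. \<phi> \<in> polynomial_maps n V m W \<and>
      (\<forall>g\<in>carrier (coord_ring m W). \<Phi> g = pullback n V m W \<phi> g)"
  proof (rule ex1I)
    show "\<phi> \<in> polynomial_maps n V m W \<and>
        (\<forall>g\<in>carrier (coord_ring m W). \<Phi> g = pullback n V m W \<phi> g)"
      using \<phi> by blast
    fix \<psi> assume \<psi>: "\<psi> \<in> polynomial_maps n V m W \<and>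
        (\<forall>g\<in>carrier (coord_ring m W). \<Phi> g = pullback n V m W \<psi> g)"
    then have \<psi>': "\<psi> \<in> polynomial_maps n V m W" by blast
    show "\<psi> = \<phi>"
      using \<phi>(2) \<psi> by (intro polynomial_map_eqI[OF assms(1) \<psi>' \<phi>(1)]) auto
  qed
qed (rule pullback_coord_fun[OF assms(1)] pullback_k_algebra_hom[OF assms(1)]
    pullback_compose[OF assms(1)]; assumption)+

end
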